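(* Let $d\ge 1$ and $J\ge 2$ be integers, and let $D=dJ$. For $U=(u^{(1)},\dots,u^{(J)})\in(\mathbb{R}^d)^J\cong\mathbb{R}^D$ let $\bar u=\frac1J\sum_{j=1}^J u^{(j)}$, let $$C(U)=\frac1J\sum_{k=1}^J (u^{(k)}-\bar u)(u^{(k)}-\bar u)^{\rm T}\in\mathbb{R}^{d\times d},$$ and let $S(U)\in\mathbb{R}^{D\times D}$ be the block diagonal matrix with $J$ diagonal blocks, each equal to $C(U)$. Then for all $U\in\mathbb{R}^D$ $$(\nabla\cdot S)(U)=\frac{d+1}{J}\,(U-\bar U)\in\mathbb{R}^D,$$ where $\bar U\in\mathbb{R}^D$ is the vector consisting of $J$ copies of $\bar u$. In particular, $\nabla\cdot S$ is not identically zero, and the product density $\pi(U)=\prod_{j=1}^J\pi^\ast(u^{(j)})$, with $\pi^\ast\propto\exp(-\Psi_R)$, is in general not invariant for the interacting particle system $$\mathrm{d}u^{(j)}=-C(U)\nabla\Psi_R(u^{(j)})\,\mathrm{d}t+\sqrt{2C(U)}\,\mathrm{d}\mathbf{W}^{(j)},\qquad j=1,\dots,J;$$ that is, it is not the case that $\pi$ is invariant for this system for every smooth potential $\Psi_R:\mathbb{R}^d\to\mathbb{R}$ with $\int_{\mathbb{R}^d}\exp(-\Psi_R(u))\,\mathrm{d}u<\infty$.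
   Context: The vector-valued divergence of a differentiable matrix field $S:\mathbb{R}^D\to\mathbb{R}^{D\times D}$ is $(\nabla\cdot S)_i=\sum_{j=1}^D\partial_j S_{ij}$, $i=1,\dots,D$. The $\mathbf{W}^{(j)}$ are independent standard Brownian motions in $\mathbb{R}^d$, the stochastic differential equations are understood in the Itô sense, and $\sqrt{2C(U)}$ is the symmetric positive semidefinite square root. The density $\pi^\ast$ is the probability density on $\mathbb{R}^d$ proportional to $\exp(-\Psi_R)$. In compact form the system reads $\mathrm{d}U=S(U)\nabla\ln\pi(U)\,\mathrm{d}t+\sqrt{2S(U)}\,\mathrm{d}\mathbf{W}$ with $\mathbf{W}$ a standard $D$-dimensional Brownian motion. The Fokker--Planck equation for the joint density $\mu$ of $U$ is $$\partial_t\mu=-\nabla\cdot(\mu\,S\nabla\ln\pi)+\sum_{i,j=1}^D\partial_i\partial_j(S_{ij}\mu)=\nabla\cdot\big(\mu\,S\nabla\{\ln\mu-\ln\pi\}+\mu\,\nabla\cdot S\big).$$ Invariance of $\pi$ means that $\pi$ is a stationary solution of this Fokker--Planck equation, equivalently that $\nabla\cdot(\pi\,\nabla\cdot S)=0$ on $\mathbb{R}^D$. *)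

theory Defs
  imports "HOL-Analysis.Analysis"
begin

text \<open>
  Dimensions are types: \<open>d = CARD('d)\<close>, \<open>J = CARD('j)\<close>, and \<open>\<real>\<^sup>D\<close> with \<open>D = d J\<close> is
  \<open>real ^ ('j \<times> 'd)\<close>; the coordinate \<open>(j, i)\<close> is the \<open>i\<close>-th coordinate of the \<open>j\<close>-th particle.
\<close>

section \<open>Differential operators\<close>

definition partial :: "'n \<Rightarrow> (real ^ 'n \<Rightarrow> real) \<Rightarrow> real ^ 'n \<Rightarrow> real" where
  "partial i f x = deriv (\<lambda>t. f (x + t *\<^sub>R axis i 1)) 0"

definition gradient :: "(real ^ 'n \<Rightarrow> real) \<Rightarrow> real ^ 'n \<Rightarrow> real ^ 'n" where
  "gradient f x = (\<chi> i. partial i f x)"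

text \<open>\<open>S x $ i $ j\<close> is the entry in row \<open>i\<close> and column \<open>j\<close>; the divergence is taken row by row.\<close>

definition matrix_divergence :: "(real ^ 'n \<Rightarrow> real ^ 'n ^ 'n) \<Rightarrow> real ^ 'n \<Rightarrow> real ^ 'n" where
  "matrix_divergence S x = (\<chi> i. \<Sum>j\<in>UNIV. partial j (\<lambda>y. S y $ i $ j) x)"

fun C_k :: "nat \<Rightarrow> (real ^ 'n \<Rightarrow> real) \<Rightarrow> bool" where
  "C_k 0 f \<longleftrightarrow> continuous_on UNIV f"
| "C_k (Suc k) f \<longleftrightarrow> f differentiable_on UNIV \<and> (\<forall>i. C_k k (partial i f))"

definition smooth :: "(real ^ 'n \<Rightarrow> real) \<Rightarrow> bool" where
  "smooth f \<longleftrightarrow> (\<forall>k. C_k k f)"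

section \<open>Positive semidefinite square root\<close>

definition sym_psd :: "real ^ 'n ^ 'n \<Rightarrow> bool" where
  "sym_psd A \<longleftrightarrow> transpose A = A \<and> (\<forall>x. 0 \<le> x \<bullet> (A *v x))"

text \<open>Only meaningful for symmetric positive semidefinite \<open>A\<close>, where the root exists uniquely.\<close>

definition psd_sqrt :: "real ^ 'n ^ 'n \<Rightarrow> real ^ 'n ^ 'n" where
  "psd_sqrt A = (THE R. sym_psd R \<and> R ** R = A)"

section \<open>Fokker--Planck equation\<close>

text \<open>
  The Fokker--Planck equation for the density \<open>\<mu> t\<close> of the Ito equation \<open>dU = b(U) dt + \<sigma>(U) dW\<close>. For
  \<open>\<sigma> = \<surd>(2 S)\<close> the second-order coefficient \<open>1/2 \<sigma> \<sigma>\<^sup>T\<close> is \<open>S\<close>.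
\<close>

definition fokker_planck_rhs ::
  "(real ^ 'n \<Rightarrow> real ^ 'n) \<Rightarrow> (real ^ 'n \<Rightarrow> real ^ 'n ^ 'n) \<Rightarrow> (real ^ 'n \<Rightarrow> real) \<Rightarrow> real ^ 'n \<Rightarrow> real"
where
  "fokker_planck_rhs b \<sigma> \<mu> x =
     - (\<Sum>i\<in>UNIV. partial i (\<lambda>y. b y $ i * \<mu> y) x)
     + (\<Sum>i\<in>UNIV. \<Sum>j\<in>UNIV.
          partial i (partial j (\<lambda>y. 1 / 2 * (\<sigma> y ** transpose (\<sigma> y)) $ i $ j * \<mu> y)) x)"

definition solves_fokker_planck ::
  "(real ^ 'n \<Rightarrow> real ^ 'n) \<Rightarrow> (real ^ 'n \<Rightarrow> real ^ 'n ^ 'n) \<Rightarrow> (real \<Rightarrow> real ^ 'n \<Rightarrow> real) \<Rightarrow> bool"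
where
  "solves_fokker_planck b \<sigma> \<mu> \<longleftrightarrow>
     (\<forall>t>0. \<forall>x. ((\<lambda>s. \<mu> s x) has_real_derivative fokker_planck_rhs b \<sigma> (\<mu> t) x) (at t))"

definition invariant_density ::
  "(real ^ 'n \<Rightarrow> real ^ 'n) \<Rightarrow> (real ^ 'n \<Rightarrow> real ^ 'n ^ 'n) \<Rightarrow> (real ^ 'n \<Rightarrow> real) \<Rightarrow> bool"
where
  "invariant_density b \<sigma> \<pi> \<longleftrightarrow> solves_fokker_planck b \<sigma> (\<lambda>t. \<pi>)"

section \<open>Ensembles and the interacting particle system\<close>

definition particle :: "real ^ ('j::finite \<times> 'd::finite) \<Rightarrow> 'j \<Rightarrow> real ^ 'd" where
  "particle U j = (\<chi> i. U $ (j, i))"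

definition stack :: "('j \<Rightarrow> real ^ 'd) \<Rightarrow> real ^ ('j::finite \<times> 'd::finite)" where
  "stack u = (\<chi> p. u (fst p) $ snd p)"

definition block_diag :: "('j \<Rightarrow> real ^ 'd ^ 'd) \<Rightarrow> real ^ ('j::finite \<times> 'd::finite) ^ ('j \<times> 'd)" where
  "block_diag B = (\<chi> p q. if fst p = fst q then B (fst p) $ snd p $ snd q else 0)"

definition ens_mean :: "real ^ ('j::finite \<times> 'd::finite) \<Rightarrow> real ^ 'd" where
  "ens_mean U = (1 / real CARD('j)) *\<^sub>R (\<Sum>j\<in>UNIV. particle U j)"

definition outer :: "real ^ 'd \<Rightarrow> real ^ 'd \<Rightarrow> real ^ 'd ^ 'd" where
  "outer x y = (\<chi> a b. x $ a * y $ b)"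

definition ens_cov :: "real ^ ('j::finite \<times> 'd::finite) \<Rightarrow> real ^ 'd ^ 'd" where
  "ens_cov U = (1 / real CARD('j)) *\<^sub>R
     (\<Sum>k\<in>UNIV. outer (particle U k - ens_mean U) (particle U k - ens_mean U))"

definition S_field :: "real ^ ('j::finite \<times> 'd::finite) \<Rightarrow> real ^ ('j::finite \<times> 'd::finite) ^ ('j \<times> 'd)" where
  "S_field U = block_diag (\<lambda>j. ens_cov U)"

definition particle_drift ::
  "(real ^ 'd \<Rightarrow> real) \<Rightarrow> real ^ ('j::finite \<times> 'd::finite) \<Rightarrow> real ^ ('j \<times> 'd)" where
  "particle_drift \<Psi> U = stack (\<lambda>j. - (ens_cov U *v gradient \<Psi> (particle U j)))"

text \<open>
  Block diagonal because particle \<open>j\<close> is driven by its own Brownian motion \<open>W\<^sub>j\<close>, independent of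
  the others; the stacked Brownian motion is standard in \<open>\<real>\<^sup>D\<close>.
\<close>

definition particle_dispersion ::
  "real ^ ('j::finite \<times> 'd::finite) \<Rightarrow> real ^ ('j::finite \<times> 'd::finite) ^ ('j \<times> 'd)" where
  "particle_dispersion U = block_diag (\<lambda>j. psd_sqrt (2 *\<^sub>R ens_cov U))"

definition target_density :: "(real ^ 'd \<Rightarrow> real) \<Rightarrow> real ^ 'd \<Rightarrow> real" where
  "target_density \<Psi> u = exp (- \<Psi> u) / (\<integral>v. exp (- \<Psi> v) \<partial>lborel)"

definition product_density ::
  "(real ^ 'd \<Rightarrow> real) \<Rightarrow> real ^ ('j::finite \<times> 'd::finite) \<Rightarrow> real" where
  "product_density \<Psi> U = (\<Prod>j\<in>UNIV. target_density \<Psi> (particle U j))"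

lemma S_field_differentiable:
  "(S_field :: real ^ ('j::finite \<times> 'd::finite) \<Rightarrow> _) differentiable (at U)"
proof -
  have "(\<lambda>V::real ^ ('j::finite \<times> 'd::finite). S_field V $ p $ q) differentiable (at U)" for p q
  proof (cases "fst p = fst q")
    case True
    have lin: "(\<lambda>V::real ^ ('j::finite \<times> 'd::finite). V $ r) differentiable (at U)" for r
      by (rule bounded_linear_imp_differentiable[OF bounded_linear_vec_nth])
    have "(\<lambda>V::real ^ ('j::finite \<times> 'd::finite). S_field V $ p $ q) =
      (\<lambda>V. (\<Sum>k\<in>UNIV. (V $ (k, snd p) - (\<Sum>j\<in>UNIV. V $ (j, snd p)) * (1 / real CARD('j)))
          * (V $ (k, snd q) - (\<Sum>j\<in>UNIV. V $ (j, snd q)) * (1 / real CARD('j))))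
        * (1 / real CARD('j)))"
      using True by (simp add: S_field_def block_diag_def ens_cov_def outer_def ens_mean_def
          particle_def fun_eq_iff)
    then show ?thesis
      by (simp only:) (intro differentiable_mult differentiable_sum differentiable_diff
          differentiable_const lin ballI finite_class.finite_UNIV)
  next
    case False
    then show ?thesis by (simp add: S_field_def block_diag_def)
  qed
  then have comp: "(\<lambda>V. S_field V $ p $ q) differentiable (at U)"
    for p q :: "'j \<times> 'd" .
  show ?thesis
    apply (subst differentiable_componentwise_within)
    apply (auto simp: Basis_vec_def inner_axis comp)
    done
qed

end

theory Submission
  imports Defs "HOL-Probability.Distributions"
begin

text \<open>
  For the failure of invariance take \<open>\<Psi>(u) = |u|\<^sup>2 / 2\<close>, so that \<open>\<pi>\<close> is a Gaussian density, and evaluate the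
  right-hand side of the Fokker--Planck equation at \<open>U = 0\<close>. The derivatives there only see \<open>\<pi>\<close> and the
  coefficients on two-dimensional coordinate planes. Entries of the diffusion matrix coupling different
  particles vanish identically. On a plane belonging to a single particle \<open>j\<close>, all other particles
  sit at \<open>0\<close>, hence \<open>C(U)\<close> is a multiple of \<open>u\<^sub>j u\<^sub>j\<^sup>T\<close> and only square roots of matrices of rank
  at most one are needed. The drift is cubic along the axes and contributes nothing, while every
  second-order term coming from a single particle is positive.
\<close>

section \<open>Divergence of the ensemble covariance\<close>

lemma partial_eqI:
  assumes "((\<lambda>t. f (x + t *\<^sub>R axis i 1)) has_real_derivative D) (at 0)"
  shows "partial i f x = D"
  using assms by (simp add: partial_def DERIV_imp_deriv)

lemma ens_mean_nth:
  "ens_mean (U :: real ^ ('j::finite \<times> 'd::finite)) $ a = (\<Sum>k\<in>UNIV. U $ (k, a)) / real CARD('j)"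
  by (simp add: ens_mean_def particle_def)

lemma ens_cov_nth:
  "ens_cov (U :: real ^ ('j::finite \<times> 'd::finite)) $ a $ b =
    (\<Sum>k\<in>UNIV. (U $ (k, a) - ens_mean U $ a) * (U $ (k, b) - ens_mean U $ b)) / real CARD('j)"
  by (simp add: ens_cov_def outer_def particle_def)

lemma sum_deviation_eq_0:
  "(\<Sum>k\<in>UNIV. (U :: real ^ ('j::finite \<times> 'd::finite)) $ (k, a) - ens_mean U $ a) = 0"
  by (simp add: sum_subtractf ens_mean_nth)

lemma ens_mean_add_axis:
  fixes U :: "real ^ ('j::finite \<times> 'd::finite)"
  shows "ens_mean (U + t *\<^sub>R axis (j, b) 1) $ a
    = ens_mean U $ a + t * (if a = b then 1 / real CARD('j) else 0)"
proof -
  have "(\<Sum>k\<in>UNIV. axis (j, b) (1::real) $ (k, a)) = (if a = b then 1 else 0)"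
    by (auto simp: axis_def)
  then show ?thesis
    by (simp add: ens_mean_nth sum.distrib sum_distrib_left[symmetric] add_divide_distrib)
qed

text \<open>Only the partials with the column index \<open>b\<close> of the entry are computed,
  since these are the ones that survive in a row divergence of a block diagonal field. They follow
  from the product rule on the deviations from the mean.\<close>

lemma partial_ens_cov:
  fixes U :: "real ^ ('j::finite \<times> 'd::finite)"
  shows "partial (j, b) (\<lambda>V. ens_cov V $ a $ b) U =
    ((if a = b then U $ (j, b) - ens_mean U $ b else 0) + (U $ (j, a) - ens_mean U $ a)) / real CARD('j)"
proof (rule partial_eqI)
  define x where "x k c = U $ (k, c) - ens_mean U $ c" for k c
  \<comment> \<open>Moving particle \<open>j\<close> shifts its own coordinate at rate 1 and the
    mean at rate 1/J, so \<open>e k\<close> is the rate of change of the deviation of particle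
    \<open>k\<close>.\<close>
  define e where "e k = (if k = j then 1 else 0) - 1 / real CARD('j)" for k
  define \<delta> :: real where "\<delta> = (if a = b then 1 else 0)"
  have dev: "(U + t *\<^sub>R axis (j, b) 1) $ (k, c) - ens_mean (U + t *\<^sub>R axis (j, b) 1) $ c
      = x k c + t * (if c = b then e k else 0)" for k c t
    unfolding ens_mean_add_axis by (auto simp: x_def e_def axis_def algebra_simps)
  have line: "(\<lambda>t. ens_cov (U + t *\<^sub>R axis (j, b) 1) $ a $ b) =
      (\<lambda>t. (\<Sum>k\<in>UNIV. (x k a + t * (\<delta> * e k)) * (x k b + t * e k)) / real CARD('j))"
    unfolding ens_cov_nth dev by (simp add: \<delta>_def)
  \<comment> \<open>The deviations sum to zero, so the -1/J part of \<open>e\<close> drops out and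
    pairing with \<open>e\<close> picks out particle \<open>j\<close>.\<close>
  have proj: "(\<Sum>k\<in>UNIV. x k c * e k) = x j c" for c
  proof -
    have "(\<Sum>k\<in>UNIV. x k c * e k) = (\<Sum>k\<in>UNIV. (if k = j then x k c else 0) - x k c * (1 / real CARD('j)))"
      by (intro sum.cong) (auto simp: e_def algebra_simps)
    also have "\<dots> = x j c - (\<Sum>k\<in>UNIV. x k c) * (1 / real CARD('j))"
      by (simp only: sum_subtractf sum_distrib_right[symmetric]) simp
    finally show ?thesis
      by (simp add: x_def sum_deviation_eq_0)
  qed
  have deriv: "((\<lambda>t. (\<Sum>k\<in>UNIV. (x k a + t * (\<delta> * e k)) * (x k b + t * e k)) / real CARD('j))
      has_real_derivative (\<Sum>k\<in>UNIV. x k a * e k + \<delta> * (x k b * e k)) / real CARD('j)) (at 0)"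
    by (auto intro!: derivative_eq_intros sum.cong simp: algebra_simps)
  show "((\<lambda>t. ens_cov (U + t *\<^sub>R axis (j, b) 1) $ a $ b) has_real_derivative
      ((if a = b then U $ (j, b) - ens_mean U $ b else 0) + (U $ (j, a) - ens_mean U $ a)) / real CARD('j))
      (at 0)"
    unfolding line
    by (rule DERIV_cong[OF deriv], unfold sum.distrib sum_distrib_left[symmetric] proj)
      (simp add: \<delta>_def x_def)
qed

lemma sum_UNIV_prod:
  "(\<Sum>p\<in>(UNIV :: ('a::finite \<times> 'b::finite) set). f p) = (\<Sum>a\<in>UNIV. \<Sum>b\<in>UNIV. f (a, b))"
  by (simp add: sum.cartesian_product)

lemma partial_const [simp]: "partial i (\<lambda>x. c) = (\<lambda>x. 0)"
  by (simp add: partial_def fun_eq_iff)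

text \<open>Each of the d columns \<open>b\<close> of the block contributes the deviation in
  coordinate \<open>a\<close> once, and the column \<open>b = a\<close> contributes it a second
  time; this gives the factor d + 1.\<close>

lemma matrix_divergence_S_field:
  fixes U :: "real ^ ('j::finite \<times> 'd::finite)"
  shows "matrix_divergence S_field U =
    ((real CARD('d) + 1) / real CARD('j)) *\<^sub>R (U - stack (\<lambda>j. ens_mean U))"
proof -
  have "matrix_divergence S_field U $ (j, a) =
      (((real CARD('d) + 1) / real CARD('j)) *\<^sub>R (U - stack (\<lambda>j. ens_mean U))) $ (j, a)" for j a
  proof -
    have block: "(\<lambda>V :: real ^ ('j \<times> 'd). S_field V $ (j, a) $ (l, b)) =
        (\<lambda>V. if j = l then ens_cov V $ a $ b else 0)" for l b
      by (auto simp: S_field_def block_diag_def)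
    have "matrix_divergence S_field U $ (j, a) =
        (\<Sum>l\<in>UNIV. \<Sum>b\<in>UNIV. if j = l then partial (j, b) (\<lambda>V. ens_cov V $ a $ b) U else 0)"
      unfolding matrix_divergence_def by (auto simp: sum_UNIV_prod block intro!: sum.cong)
    also have "\<dots> = (\<Sum>b\<in>UNIV. partial (j, b) (\<lambda>V. ens_cov V $ a $ b) U)"
      by (subst sum.swap) simp
    also have "\<dots> = ((real CARD('d) + 1) / real CARD('j)) * (U $ (j, a) - ens_mean U $ a)"
      unfolding partial_ens_cov sum_divide_distrib[symmetric] sum.distrib
      by (simp add: distrib_right)
    finally show ?thesis
      by (simp add: stack_def)
  qed
  then show ?thesis
    by (simp add: vec_eq_iff)
qed

section \<open>Square roots of matrices of rank one\<close>

lemma outer_mult_vec: "outer x y *v z = (y \<bullet> z) *\<^sub>R x"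
  by (simp add: vec_eq_iff outer_def matrix_vector_mult_def inner_vec_def sum_distrib_left mult_ac)

text \<open>Since \<open>psd_sqrt\<close> is a definite description, both existence and uniqueness
  of the root are required. Uniqueness holds because a root kills the orthogonal complement of
  \<open>v\<close> and has \<open>v\<close> as an eigenvector with a prescribed nonnegative
  eigenvalue.\<close>

lemma psd_sqrt_outer:
  fixes v :: "real ^ 'n"
  assumes "0 \<le> c"
  shows "psd_sqrt (c *\<^sub>R outer v v) ** psd_sqrt (c *\<^sub>R outer v v) = c *\<^sub>R outer v v"
    and "transpose (psd_sqrt (c *\<^sub>R outer v v)) = psd_sqrt (c *\<^sub>R outer v v)"
proof -
  \<comment> \<open>The square of \<open>outer v v\<close> is |v|^2 times itself, hence the division
    by \<open>norm v\<close>. For \<open>v = 0\<close> division by zero gives 0, and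
    \<open>R0 = 0\<close> is still the right root.\<close>
  define R0 where "R0 = (sqrt c / norm v) *\<^sub>R outer v v"
  have mv: "(k *\<^sub>R outer v v) *v x = (k * (v \<bullet> x)) *\<^sub>R v" for k x
    by (simp add: scaleR_matrix_vector_assoc[symmetric] outer_mult_vec)
  have "R0 ** R0 = c *\<^sub>R outer v v"
  proof (subst matrix_eq, rule allI)
    fix x
    show "(R0 ** R0) *v x = (c *\<^sub>R outer v v) *v x"
      unfolding R0_def matrix_vector_mul_assoc[symmetric] mv
      using assms by (cases "v = 0") (simp_all add: dot_square_norm power2_eq_square field_simps)
  qed
  moreover have "sym_psd R0"
  proof -
    have "transpose R0 = R0"
      by (simp add: R0_def transpose_def outer_def vec_eq_iff)
    moreover have "0 \<le> x \<bullet> (R0 *v x)" for x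
      using assms by (simp add: R0_def mv inner_commute mult.assoc)
    ultimately show ?thesis
      by (simp add: sym_psd_def)
  qed
  moreover have "R = R0" if "sym_psd R" and sq: "R ** R = c *\<^sub>R outer v v" for R
  proof -
    have tr: "transpose R = R" and pos: "0 \<le> x \<bullet> (R *v x)" for x
      using \<open>sym_psd R\<close> by (auto simp: sym_psd_def)
    have sym: "(R *v x) \<bullet> y = x \<bullet> (R *v y)" for x y
      using dot_lmul_matrix[of x R y] tr by (metis transpose_matrix_vector)
    have RR: "R *v (R *v x) = (c * (v \<bullet> x)) *\<^sub>R v" for x
      by (simp add: matrix_vector_mul_assoc sq mv)
    \<comment> \<open>By symmetry |R x|^2 is the inner product of x with R (R x), which is a
      multiple of \<open>v \<bullet> x\<close>.\<close>
    have ker: "R *v x = 0" if "v \<bullet> x = 0" for x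
    proof -
      have "(R *v x) \<bullet> (R *v x) = 0"
        by (simp add: sym RR that)
      then show ?thesis by simp
    qed
    show ?thesis
    proof (cases "v = 0")
      case True
      then show ?thesis
        using ker by (subst matrix_eq) (simp add: R0_def mv)
    next
      case False
      define \<mu> where "\<mu> = (v \<bullet> (R *v v)) / (v \<bullet> v)"
      have vv: "v \<bullet> v > 0"
        using False by simp
      \<comment> \<open>Subtracting from \<open>x\<close> its projection onto \<open>v\<close>
        leaves a vector in the kernel.\<close>
      have rv: "R *v x = ((v \<bullet> x) / (v \<bullet> v)) *\<^sub>R (R *v v)" for x
      proof -
        have "R *v (x - ((v \<bullet> x) / (v \<bullet> v)) *\<^sub>R v) = 0"
          using vv by (intro ker) (simp add: inner_diff_right)
        then show ?thesis
          by (simp add: matrix_vector_mult_diff_distrib matrix_vector_mult_scaleR)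
      qed
      have Rv: "R *v v = \<mu> *\<^sub>R v"
      proof (rule vector_eq_rdot[THEN iffD1], rule allI)
        fix x
        have "(R *v v) \<bullet> x = v \<bullet> (R *v x)"
          by (rule sym)
        also have "\<dots> = (\<mu> *\<^sub>R v) \<bullet> x"
          by (subst rv) (simp add: \<mu>_def)
        finally show "(R *v v) \<bullet> x = (\<mu> *\<^sub>R v) \<bullet> x" .
      qed
      have "\<mu> \<ge> 0"
        using pos[of v] vv by (simp add: \<mu>_def)
      have "(\<mu> * \<mu>) *\<^sub>R v = (c * (v \<bullet> v)) *\<^sub>R v"
        using RR[of v] by (simp add: Rv matrix_vector_mult_scaleR)
      then have "\<mu>\<^sup>2 = c * (norm v)\<^sup>2"
        using False by (simp add: power2_eq_square dot_square_norm)
      \<comment> \<open>Positivity of \<open>R\<close> selects the nonnegative one of the two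
        possible eigenvalues.\<close>
      then have "\<mu> = sqrt c * norm v"
        using \<open>\<mu> \<ge> 0\<close> by (metis norm_ge_zero real_sqrt_abs real_sqrt_mult abs_of_nonneg)
      then show ?thesis
        using False by (subst matrix_eq, subst rv)
          (simp add: R0_def mv Rv dot_square_norm power2_eq_square)
    qed
  qed
  ultimately have "sym_psd (psd_sqrt (c *\<^sub>R outer v v)) \<and>
      psd_sqrt (c *\<^sub>R outer v v) ** psd_sqrt (c *\<^sub>R outer v v) = c *\<^sub>R outer v v"
    unfolding psd_sqrt_def by (intro theI'[of "\<lambda>R. sym_psd R \<and> R ** R = c *\<^sub>R outer v v"]) blast
  then show "psd_sqrt (c *\<^sub>R outer v v) ** psd_sqrt (c *\<^sub>R outer v v) = c *\<^sub>R outer v v"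
    and "transpose (psd_sqrt (c *\<^sub>R outer v v)) = psd_sqrt (c *\<^sub>R outer v v)"
    by (auto simp: sym_psd_def)
qed

section \<open>The standard Gaussian potential\<close>

lemma partial_nth: "partial i (\<lambda>x. x $ j) = (\<lambda>x. if i = j then 1 else 0)"
  by (rule ext, rule partial_eqI) (auto intro!: derivative_eq_intros simp: axis_def)

lemma partial_half_square: "partial i (\<lambda>x. (x \<bullet> x) / 2) = (\<lambda>x. x $ i)"
  by (rule ext, rule partial_eqI)
    (auto intro!: derivative_eq_intros simp: inner_add_left inner_add_right inner_axis inner_commute)

lemma C_k_const: "C_k k (\<lambda>x. c)"
  by (induction k arbitrary: c) (auto)

lemma C_k_nth: "C_k k (\<lambda>x. x $ i)"
proof (cases k)
  case 0
  then show ?thesis by (simp add: continuous_on_component continuous_on_id)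
next
  case (Suc m)
  then show ?thesis
    by (auto simp: partial_nth C_k_const differentiable_on_def
        intro!: bounded_linear_imp_differentiable[OF bounded_linear_vec_nth])
qed

lemma smooth_half_square: "smooth (\<lambda>x :: real ^ 'n. (x \<bullet> x) / 2)"
proof -
  have "C_k k (\<lambda>x :: real ^ 'n. (x \<bullet> x) / 2)" for k
  proof (cases k)
    case 0
    then show ?thesis by (auto intro!: continuous_intros)
  next
    case (Suc m)
    have "(\<lambda>x :: real ^ 'n. (x \<bullet> x) / 2) differentiable_on UNIV"
      by (auto simp: differentiable_on_def intro!: differentiable_divide)
    then show ?thesis
      by (simp add: Suc partial_half_square C_k_nth)
  qed
  then show ?thesis by (simp add: smooth_def)
qed

text \<open>The Gaussian factors over the orthonormal basis, and \<open>lborel\<close> is by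
  definition the image of the product of one-dimensional Lebesgue measures under the coordinate
  map.\<close>

lemma integrable_gaussian:
  "integrable lborel (\<lambda>x :: 'a::euclidean_space. exp (- ((x \<bullet> x) / 2)))"
proof -
  interpret product_sigma_finite "\<lambda>_ :: 'a. lborel :: real measure" ..
  have "integrable lborel (\<lambda>x :: real. exp (- (x\<^sup>2 / 2)))"
    \<comment> \<open>The zeroth moment of the standard normal density, with its normalising factor
      removed.\<close>
    using integrable_mult_right[OF integrable_std_normal_moment[of 0], of "sqrt (2 * pi)"]
    by (simp add: std_normal_density_def)
  then have "integrable (\<Pi>\<^sub>M b\<in>Basis. lborel) (\<lambda>f :: 'a \<Rightarrow> real. \<Prod>b\<in>Basis. exp (- ((f b)\<^sup>2 / 2)))"
    by (intro product_integrable_prod) auto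
  also have "(\<lambda>f :: 'a \<Rightarrow> real. \<Prod>b\<in>Basis. exp (- ((f b)\<^sup>2 / 2))) =
      (\<lambda>f. exp (- (((\<Sum>b\<in>Basis. f b *\<^sub>R b) \<bullet> (\<Sum>b\<in>Basis. f b *\<^sub>R b)) / 2)))"
    by (rule ext, subst euclidean_inner)
      (simp add: exp_sum[symmetric] sum_negf sum_divide_distrib power2_eq_square)
  finally show ?thesis
    by (subst lborel_def, subst integrable_distr_eq) (simp_all add: lborel_eq_real)
qed

text \<open>A nonnegative function with zero integral vanishes almost everywhere, but the
  exponential vanishes nowhere. This makes the normalised density a genuine positive multiple of the
  Gaussian.\<close>

lemma integral_gaussian_pos:
  "0 < (\<integral>(x :: 'a::euclidean_space). exp (- ((x \<bullet> x) / 2)) \<partial>lborel)"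
proof -
  have "(\<integral>(x :: 'a). exp (- ((x \<bullet> x) / 2)) \<partial>lborel) \<noteq> 0"
  proof
    assume "(\<integral>(x :: 'a). exp (- ((x \<bullet> x) / 2)) \<partial>lborel) = 0"
    then have "AE (x :: 'a) in lborel. False"
      using integral_nonneg_eq_0_iff_AE[OF integrable_gaussian[where 'a='a]] by simp
    then show False
      by (simp add: trivial_limit_def[symmetric] ae_filter_eq_bot_iff)
  qed
  moreover have "0 \<le> (\<integral>(x :: 'a). exp (- ((x \<bullet> x) / 2)) \<partial>lborel)"
    by (intro Bochner_Integration.integral_nonneg) simp
  ultimately show ?thesis by linarith
qed

lemma product_density_gaussian:
  obtains K where "0 < K"
    and "product_density (\<lambda>u. (u \<bullet> u) / 2) =
      (\<lambda>U :: real ^ ('j::finite \<times> 'd::finite). K * exp (- ((U \<bullet> U) / 2)))"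
proof
  let ?Z = "\<integral>(v :: real ^ 'd). exp (- ((v \<bullet> v) / 2)) \<partial>lborel"
  show "0 < (1 / ?Z) ^ CARD('j)"
    using integral_gaussian_pos[where 'a = "real ^ 'd"] by simp
  have norm_sq: "(\<Sum>j\<in>UNIV. particle U j \<bullet> particle U j) = U \<bullet> U" for U :: "real ^ ('j \<times> 'd)"
    by (simp add: inner_vec_def particle_def sum_UNIV_prod)
  show "product_density (\<lambda>u. (u \<bullet> u) / 2) =
      (\<lambda>U :: real ^ ('j \<times> 'd). (1 / ?Z) ^ CARD('j) * exp (- ((U \<bullet> U) / 2)))"
  proof
    fix U :: "real ^ ('j \<times> 'd)"
    have "product_density (\<lambda>u. (u \<bullet> u) / 2) U =
        (\<Prod>j\<in>UNIV. (1 / ?Z) * exp (- ((particle U j \<bullet> particle U j) / 2)))"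
      by (simp add: product_density_def target_density_def)
    also have "\<dots> = (1 / ?Z) ^ CARD('j) * (\<Prod>j\<in>UNIV. exp (- ((particle U j \<bullet> particle U j) / 2)))"
      by (simp only: prod.distrib prod_constant)
    also have "(\<Prod>j\<in>UNIV. exp (- ((particle U j \<bullet> particle U j) / 2))) = exp (- ((U \<bullet> U) / 2))"
      by (simp add: exp_sum[symmetric] sum_negf sum_divide_distrib[symmetric] norm_sq)
    finally show "product_density (\<lambda>u. (u \<bullet> u) / 2) U = (1 / ?Z) ^ CARD('j) * exp (- ((U \<bullet> U) / 2))" .
  qed
qed

section \<open>The Fokker-Planck operator at the origin\<close>

text \<open>The mean is v/J, so every deviation is a multiple of \<open>v\<close> and the covariance
  has rank at most one.\<close>

lemma ens_cov_single:
  fixes v :: "real ^ 'd::finite" and j :: "'j::finite"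
  shows "ens_cov (stack (\<lambda>k. if k = j then v else 0)) =
    ((1 - 1 / real CARD('j)) / real CARD('j)) *\<^sub>R outer v v"
proof -
  define J where "J = real CARD('j)"
  have J: "J > 0" by (simp add: J_def)
  let ?U = "stack (\<lambda>k. if k = j then v else 0)"
  have m: "ens_mean ?U $ a = v $ a / J" for a
    by (simp add: ens_mean_nth stack_def J_def if_distrib[of "\<lambda>x. x $ a"] cong: if_cong)
  have "(\<Sum>k\<in>UNIV. (?U $ (k, a) - v $ a / J) * (?U $ (k, b) - v $ b / J)) = (1 - 1 / J) * (v $ a * v $ b)"
    for a b
  proof -
    \<comment> \<open>Every particle contributes the product of the two mean entries; particle
      \<open>j\<close> adds what remains after expanding (1 - 1/J)^2 = 1 - 2/J + 1/J^2.\<close>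
    have "(\<Sum>k\<in>UNIV. (?U $ (k, a) - v $ a / J) * (?U $ (k, b) - v $ b / J)) =
        (\<Sum>k\<in>UNIV. (if k = j then v $ a * v $ b * (1 - 2 / J) else 0) + v $ a * v $ b / J\<^sup>2)"
      by (intro sum.cong) (auto simp: stack_def algebra_simps power2_eq_square)
    also have "\<dots> = v $ a * v $ b * (1 - 2 / J) + J * (v $ a * v $ b / J\<^sup>2)"
      by (simp add: sum.distrib J_def)
    also have "\<dots> = (1 - 1 / J) * (v $ a * v $ b)"
      using J by (simp add: field_simps power2_eq_square)
    finally show ?thesis .
  qed
  then show ?thesis
    by (simp add: vec_eq_iff ens_cov_nth m outer_def J_def)
qed

text \<open>Entries coupling different particles vanish for arbitrary blocks, so they require no
  knowledge of \<open>psd_sqrt\<close>.\<close>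

lemma block_diag_self_transpose:
  "(block_diag B ** transpose (block_diag B)) $ (j, a) $ (l, b) =
    (if j = l then (B j ** transpose (B j)) $ a $ b else 0)"
proof -
  have "(block_diag B ** transpose (block_diag B)) $ (j, a) $ (l, b) =
      (\<Sum>k\<in>UNIV. \<Sum>c\<in>UNIV. if k = j then (if j = l then B j $ a $ c * B j $ b $ c else 0) else 0)"
    by (auto simp: matrix_matrix_mult_def transpose_def block_diag_def sum_UNIV_prod intro!: sum.cong)
  also have "\<dots> = (\<Sum>c\<in>UNIV. if j = l then B j $ a $ c * B j $ b $ c else 0)"
    by (subst sum.swap) simp
  finally show ?thesis
    by (simp add: matrix_matrix_mult_def transpose_def)
qed

text \<open>The covariance is a nonnegative multiple of \<open>outer v v\<close> here, so the root
  can be squared away: half of 2C is C.\<close>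

lemma diffusion_single:
  fixes v :: "real ^ 'd::finite" and j :: "'j::finite"
  defines "U \<equiv> stack (\<lambda>k. if k = j then v else 0)"
  shows "1 / 2 * (particle_dispersion U ** transpose (particle_dispersion U)) $ (j, a) $ (j, b) =
    (1 - 1 / real CARD('j)) / real CARD('j) * (v $ a * v $ b)"
proof -
  define \<kappa> where "\<kappa> = (1 - 1 / real CARD('j)) / real CARD('j)"
  have "\<kappa> \<ge> 0"
    by (simp add: \<kappa>_def)
  then have "psd_sqrt ((2 * \<kappa>) *\<^sub>R outer v v) ** transpose (psd_sqrt ((2 * \<kappa>) *\<^sub>R outer v v))
      = (2 * \<kappa>) *\<^sub>R outer v v"
    by (simp add: psd_sqrt_outer)
  then show ?thesis
    unfolding U_def particle_dispersion_def block_diag_self_transpose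
    by (simp add: ens_cov_single \<kappa>_def[symmetric] outer_def)
qed

lemma stack_nth: "stack u $ (j, a) = u j $ a"
  by (simp add: stack_def)

lemma particle_stack: "particle (stack u) j = u j"
  by (simp add: particle_def stack_nth)

lemma fokker_planck_rhs_gaussian_pos:
  fixes K :: real
  assumes J: "CARD('j::finite) \<ge> 2" and "0 < K"
  shows "0 < fokker_planck_rhs (particle_drift (\<lambda>u. (u \<bullet> u) / 2)) particle_dispersion
    (\<lambda>U. K * exp (- ((U \<bullet> U) / 2))) (0 :: real ^ ('j \<times> 'd::finite))"
proof -
  let ?b = "particle_drift (\<lambda>u. (u \<bullet> u) / 2) :: real ^ ('j \<times> 'd) \<Rightarrow> _"
  let ?A = "\<lambda>U :: real ^ ('j \<times> 'd). \<lambda>p q.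
    1 / 2 * (particle_dispersion U ** transpose (particle_dispersion U)) $ p $ q"
  let ?\<mu> = "\<lambda>U :: real ^ ('j \<times> 'd). K * exp (- ((U \<bullet> U) / 2))"
  define \<kappa> where "\<kappa> = (1 - 1 / real CARD('j)) / real CARD('j)"
  \<comment> \<open>At least two particles are needed: a single particle has zero
    covariance.\<close>
  have "\<kappa> > 0"
    using J by (simp add: \<kappa>_def)
  have drift: "partial p (\<lambda>U. ?b U $ p * ?\<mu> U) 0 = 0" for p :: "'j \<times> 'd"
  proof (rule partial_eqI)
    obtain j a where p: "p = (j, a)" by fastforce
    have grad: "gradient (\<lambda>u. (u \<bullet> u) / 2) (x :: real ^ 'd) = x" for x
      by (simp add: gradient_def partial_half_square)
    have line: "t *\<^sub>R axis (j, a) 1 = stack (\<lambda>k. if k = j then t *\<^sub>R axis a 1 else 0)" for t :: real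
      by (simp add: vec_eq_iff stack_def axis_def)
    \<comment> \<open>On this axis the covariance is \<open>\<kappa> * t^2\<close> times a
      projection and the gradient is the position itself, so the drift is cubic and its derivative
      at 0 vanishes.\<close>
    have "?b (t *\<^sub>R axis (j, a) 1) $ (j, a) = - (\<kappa> * t ^ 3)" for t
      unfolding line
      by (simp add: particle_drift_def stack_nth particle_stack grad ens_cov_single \<kappa>_def[symmetric]
          scaleR_matrix_vector_assoc[symmetric] outer_mult_vec inner_axis_axis power3_eq_cube)
    then have "(\<lambda>t. ?b (0 + t *\<^sub>R axis p 1) $ p * ?\<mu> (0 + t *\<^sub>R axis p 1)) =
        (\<lambda>t. - (\<kappa> * t ^ 3) * (K * exp (- (t\<^sup>2 / 2))))"
      by (simp add: p power2_eq_square inner_axis_axis)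
    then show "((\<lambda>t. ?b (0 + t *\<^sub>R axis p 1) $ p * ?\<mu> (0 + t *\<^sub>R axis p 1)) has_real_derivative 0) (at 0)"
      by (auto intro!: derivative_eq_intros)
  qed
  \<comment> \<open>To leading order the coefficient is \<open>\<kappa> * K\<close> times the
    product of coordinates \<open>a\<close> and \<open>b\<close>, whose mixed second derivative is
    1, or 2 when they coincide. The exponential only adds terms of higher order.\<close>
  have diag: "partial (j, a) (partial (j, b) (\<lambda>U. ?A U (j, a) (j, b) * ?\<mu> U)) 0
      = \<kappa> * K * (if a = b then 2 else 1)" for j :: 'j and a b :: 'd
  proof (rule partial_eqI)
    have plane: "t *\<^sub>R axis (j, a) 1 + s *\<^sub>R axis (j, b) 1 =
        stack (\<lambda>k. if k = j then t *\<^sub>R axis a 1 + s *\<^sub>R axis b 1 else 0)" for t s :: real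
      by (simp add: vec_eq_iff stack_def axis_def)
    \<comment> \<open>With \<delta> the case \<open>a = b\<close>, where the plane degenerates to a
      line, is treated together with \<open>a \<noteq> b\<close>.\<close>
    define \<delta> :: real where "\<delta> = (if a = b then 1 else 0)"
    have val: "?A (t *\<^sub>R axis (j, a) 1 + s *\<^sub>R axis (j, b) 1) (j, a) (j, b) *
          ?\<mu> (t *\<^sub>R axis (j, a) 1 + s *\<^sub>R axis (j, b) 1) =
        \<kappa> * ((t + s * \<delta>) * (t * \<delta> + s)) * (K * exp (- ((t * t + 2 * t * s * \<delta> + s * s) / 2)))" for t s
    proof -
      have A: "?A (t *\<^sub>R axis (j, a) 1 + s *\<^sub>R axis (j, b) 1) (j, a) (j, b) =
          \<kappa> * ((t + s * \<delta>) * (t * \<delta> + s))"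
        unfolding plane diffusion_single by (simp add: \<kappa>_def \<delta>_def axis_def)
      have "(t *\<^sub>R axis (j, a) (1 :: real) + s *\<^sub>R axis (j, b) 1) \<bullet> (t *\<^sub>R axis (j, a) 1 + s *\<^sub>R axis (j, b) 1) =
          t * t + 2 * t * s * \<delta> + s * s"
        by (simp add: inner_add_left inner_add_right inner_axis_axis \<delta>_def algebra_simps)
      then show ?thesis
        unfolding A by simp
    qed
    have "partial (j, b) (\<lambda>U. ?A U (j, a) (j, b) * ?\<mu> U) (0 + t *\<^sub>R axis (j, a) 1) =
        \<kappa> * K * (t + t * \<delta> * \<delta> - t * t * t * \<delta> * \<delta>) * exp (- (t * t / 2))" for t
      by (rule partial_eqI, unfold add_0 val)
        (auto intro!: derivative_eq_intros simp: field_simps)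
    then have inner: "(\<lambda>t. partial (j, b) (\<lambda>U. ?A U (j, a) (j, b) * ?\<mu> U) (0 + t *\<^sub>R axis (j, a) 1)) =
        (\<lambda>t. \<kappa> * K * (t + t * \<delta> * \<delta> - t * t * t * \<delta> * \<delta>) * exp (- (t * t / 2)))" by blast
    show "((\<lambda>t. partial (j, b) (\<lambda>U. ?A U (j, a) (j, b) * ?\<mu> U) (0 + t *\<^sub>R axis (j, a) 1))
        has_real_derivative \<kappa> * K * (if a = b then 2 else 1)) (at 0)"
      unfolding inner by (auto intro!: derivative_eq_intros simp: \<delta>_def)
  qed
  have "(\<Sum>p\<in>UNIV. \<Sum>q\<in>UNIV. partial p (partial q (\<lambda>U. ?A U p q * ?\<mu> U)) 0) > 0"
  proof (rule sum_pos)
    fix p :: "'j \<times> 'd"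
    obtain j a where p: "p = (j, a)" by fastforce
    have same: "partial (j, a) (partial (j, b) (\<lambda>U. ?A U (j, a) (j, b) * ?\<mu> U)) 0 > 0" for b
      using \<open>\<kappa> > 0\<close> \<open>0 < K\<close> by (simp only: diag) simp
    have off: "partial (j, a) (partial (l, b) (\<lambda>U. ?A U (j, a) (l, b) * ?\<mu> U)) 0 = 0"
      if "j \<noteq> l" for l b
      using that by (simp add: particle_dispersion_def block_diag_self_transpose)
    \<comment> \<open>The diagonal term \<open>q = (j, a)\<close> is strictly positive and all
      others are nonnegative.\<close>
    show "0 < (\<Sum>q\<in>UNIV. partial p (partial q (\<lambda>U. ?A U p q * ?\<mu> U)) 0)"
    proof (rule sum_pos2[where i = "(j, a)"])
      fix q :: "'j \<times> 'd"
      obtain l b where q: "q = (l, b)" by fastforce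
      show "0 \<le> partial p (partial q (\<lambda>U. ?A U p q * ?\<mu> U)) 0"
        unfolding p q using same[of b] off[of l b] by (cases "j = l") auto
    qed (use same[of a] in \<open>auto simp only: p finite_class.finite_UNIV UNIV_I\<close>)
  qed simp_all
  then show ?thesis
    unfolding fokker_planck_rhs_def by (simp add: drift)
qed

theorem lemma2p1:
  assumes "CARD('j::finite) \<ge> 2"
  shows "(\<forall>U :: real ^ ('j \<times> 'd::finite).
            matrix_divergence S_field U
              = ((real CARD('d) + 1) / real CARD('j)) *\<^sub>R (U - stack (\<lambda>j. ens_mean U)))
       \<and> (\<exists>U :: real ^ ('j \<times> 'd). matrix_divergence S_field U \<noteq> 0)
       \<and> \<not> (\<forall>\<Psi> :: real ^ 'd \<Rightarrow> real.
              smooth \<Psi> \<longrightarrow> integrable lborel (\<lambda>u. exp (- \<Psi> u)) \<longrightarrow>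
              invariant_density
                (particle_drift \<Psi> :: real ^ ('j \<times> 'd) \<Rightarrow> real ^ ('j \<times> 'd))
                particle_dispersion
                (product_density \<Psi>))"
proof (intro conjI)
  show "\<forall>U :: real ^ ('j \<times> 'd). matrix_divergence S_field U
      = ((real CARD('d) + 1) / real CARD('j)) *\<^sub>R (U - stack (\<lambda>j. ens_mean U))"
    by (simp add: matrix_divergence_S_field)
  show "\<exists>U :: real ^ ('j \<times> 'd). matrix_divergence S_field U \<noteq> 0"
  proof
    fix j :: 'j and a :: 'd
    \<comment> \<open>One particle is displaced by a unit vector and the rest stay at 0; with J at
      least 2 it differs from the mean.\<close>
    let ?U = "axis (j, a) 1 :: real ^ ('j \<times> 'd)"
    have "(?U - stack (\<lambda>j. ens_mean ?U)) $ (j, a) = 1 - 1 / real CARD('j)"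
      using ens_mean_add_axis[of 0 1 j a a] by (simp add: stack_def ens_mean_nth)
    also have "\<dots> \<noteq> 0"
      using assms by simp
    finally have "?U - stack (\<lambda>j. ens_mean ?U) \<noteq> 0"
      by force
    then show "matrix_divergence S_field ?U \<noteq> 0"
      unfolding matrix_divergence_S_field by (simp add: add_nonneg_eq_0_iff)
  qed
  show "\<not> (\<forall>\<Psi> :: real ^ 'd \<Rightarrow> real. smooth \<Psi> \<longrightarrow> integrable lborel (\<lambda>u. exp (- \<Psi> u)) \<longrightarrow>
      invariant_density (particle_drift \<Psi> :: real ^ ('j \<times> 'd) \<Rightarrow> real ^ ('j \<times> 'd))
        particle_dispersion (product_density \<Psi>))"
  proof
    let ?\<Psi> = "\<lambda>u :: real ^ 'd. (u \<bullet> u) / 2"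
    let ?rhs = "fokker_planck_rhs (particle_drift ?\<Psi>) particle_dispersion (product_density ?\<Psi>)
      (0 :: real ^ ('j \<times> 'd))"
    assume "\<forall>\<Psi> :: real ^ 'd \<Rightarrow> real. smooth \<Psi> \<longrightarrow> integrable lborel (\<lambda>u. exp (- \<Psi> u)) \<longrightarrow>
      invariant_density (particle_drift \<Psi> :: real ^ ('j \<times> 'd) \<Rightarrow> real ^ ('j \<times> 'd))
        particle_dispersion (product_density \<Psi>)"
    then have "invariant_density (particle_drift ?\<Psi> :: real ^ ('j \<times> 'd) \<Rightarrow> _)
        particle_dispersion (product_density ?\<Psi>)"
      using smooth_half_square integrable_gaussian by blast
    \<comment> \<open>Any positive time would do: the density is constant in time, so the right-hand
      side must be 0.\<close>
    then have "((\<lambda>s. product_density ?\<Psi> (0 :: real ^ ('j \<times> 'd))) has_real_derivative ?rhs) (at 1)"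
      by (simp add: invariant_density_def solves_fokker_planck_def)
    then have "?rhs = 0"
      using DERIV_unique DERIV_const by blast
    moreover obtain K where "0 < K"
      "product_density ?\<Psi> = (\<lambda>U :: real ^ ('j \<times> 'd). K * exp (- ((U \<bullet> U) / 2)))"
      by (rule product_density_gaussian)
    ultimately show False
      using fokker_planck_rhs_gaussian_pos[OF assms \<open>0 < K\<close>, where 'd = 'd] by simp
  qed
qed

end
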